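(* Let $\theta(q,z):=\sum_{j=0}^{\infty}q^{j(j+1)/2}z^j$, and for $a>0$ let $D(a):=\{q\in\mathbb{C} : 0<|q|\le a,\ \arg(q)\in[\pi/2,3\pi/2]\}$. (1) For every $q\in D(0.55)$, the zeros of $\theta(q,\cdot)$ are strongly separated in modulus. That is: for every integer $k\ge 2$ there is exactly one zero $\xi_k$ of $\theta(q,\cdot)$ in the open annulus $U_{k-1/2,k+1/2}=\{|q|^{-k+1/2}<|z|<|q|^{-k-1/2}\}$, and it is a simple zero; there is exactly one zero $\xi_1$ of $\theta(q,\cdot)$ in the punctured disk $\{0<|z|<|q|^{-3/2}\}$, and it is a simple zero; and $\theta(q,\cdot)$ has no zeros other than the $\xi_k$, $k\ge 1$. (2) For every $q\in D(0.6)$: for every integer $k\ge 4$ there is exactly one zero of $\theta(q,\cdot)$ in the open annulus $U_{k-1/2,k+1/2}=\{|q|^{-k+1/2}<|z|<|q|^{-k-1/2}\}$, and it is a simple zero; there is exactly one zero of $\theta(q,\cdot)$ in the punctured disk $\{0<|z|<|q|^{-3/2}\}$, and it is a simple zero; and $\theta(q,\cdot)$ has exactly two zeros, counted with multiplicity, in the open annulus $U_{3/2,7/2}=\{|q|^{-3/2}<|z|<|q|^{-7/2}\}$.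
   Context: The partial theta function is $\theta(q,z):=\sum_{j=0}^{\infty}q^{j(j+1)/2}z^j$, with parameter $q\in\mathbb{C}$, $0<|q|<1$, and variable $z\in\mathbb{C}$; for fixed $q$ it is an entire function of $z$. For $0<a<b$ and $q$ fixed, $U_{a,b}:=\{z\in\mathbb{C}: |q|^{-a}<|z|<|q|^{-b}\}$. For $q$ fixed, strong separation in modulus of the zeros of $\theta$ for $k\ge k_0$ means: for every $k\ge k_0$ there is a unique zero $\xi_k$ of $\theta(q,\cdot)$, which is simple, with $\xi_k\in U_{k-1/2,k+1/2}$ if $k\ge2$ and $0<|\xi_k|<|q|^{-3/2}$ if $k=1$, while the remaining $k_0-1$ zeros (counted with multiplicity) lie in $\{0<|z|<|q|^{-k_0+1/2}\}$. The zeros are called strongly separated if this holds with $k_0=1$. *)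

theory Defs
  imports "HOL-Complex_Analysis.Complex_Analysis"
begin

definition partial_theta :: "complex \<Rightarrow> complex \<Rightarrow> complex" where
  "partial_theta q z = (\<Sum>j. q ^ (j * (j + 1) div 2) * z ^ j)"

definition theta_sector :: "real \<Rightarrow> complex set" where
  "theta_sector a = {q. 0 < norm q \<and> norm q \<le> a \<and> Arg2pi q \<in> {pi / 2..3 * pi / 2}}"

definition theta_annulus :: "complex \<Rightarrow> real \<Rightarrow> real \<Rightarrow> complex set" where
  "theta_annulus q a b = {z. norm q powr (- a) < norm z \<and> norm z < norm q powr (- b)}"

definition theta_disk :: "complex \<Rightarrow> real \<Rightarrow> complex set" where
  "theta_disk q b = {z. 0 < norm z \<and> norm z < norm q powr (- b)}"

definition zeros_in :: "(complex \<Rightarrow> complex) \<Rightarrow> complex set \<Rightarrow> complex set" where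
  "zeros_in f S = {z \<in> S. f z = 0}"

definition only_simple_zero_in :: "(complex \<Rightarrow> complex) \<Rightarrow> complex set \<Rightarrow> complex \<Rightarrow> bool" where
  "only_simple_zero_in f S w \<longleftrightarrow> zeros_in f S = {w} \<and> zorder f w = 1"

(* Finiteness is required explicitly because a sum over an infinite set is 0. *)
definition has_zero_count :: "(complex \<Rightarrow> complex) \<Rightarrow> complex set \<Rightarrow> nat \<Rightarrow> bool" where
  "has_zero_count f S n \<longleftrightarrow> finite (zeros_in f S) \<and> (\<Sum>z\<in>zeros_in f S. zorder f z) = int n"

definition theta_region :: "complex \<Rightarrow> nat \<Rightarrow> complex set" where
  "theta_region q k =
    (if k = 1 then theta_disk q (3 / 2) else theta_annulus q (real k - 1 / 2) (real k + 1 / 2))"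

(* Meaningful for k0 \<ge> 1 only. *)
definition strongly_separated_from :: "complex \<Rightarrow> nat \<Rightarrow> bool" where
  "strongly_separated_from q k0 \<longleftrightarrow>
    (\<exists>\<xi>::nat \<Rightarrow> complex.
      (\<forall>k\<ge>k0. only_simple_zero_in (partial_theta q) (theta_region q k) (\<xi> k)) \<and>
      zeros_in (partial_theta q) (- (\<xi> ` {k0..})) \<subseteq> theta_disk q (real k0 - 1 / 2) \<and>
      has_zero_count (partial_theta q) (- (\<xi> ` {k0..})) (k0 - 1))"

definition strongly_separated :: "complex \<Rightarrow> bool" where
  "strongly_separated q \<longleftrightarrow> strongly_separated_from q 1"

lemma summable_partial_theta:
  fixes q z :: complex
  assumes "norm q < 1"
  shows "summable (\<lambda>j. q ^ (j * (j + 1) div 2) * z ^ j)"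
proof -
  have "(\<lambda>j. norm q ^ Suc j * norm z) \<longlonglongrightarrow> 0 * norm z"
    by (intro tendsto_mult tendsto_const LIMSEQ_Suc LIMSEQ_power_zero) (use assms in auto)
  hence "eventually (\<lambda>j. norm q ^ Suc j * norm z < 1 / 2) sequentially"
    by (intro order_tendstoD) auto
  then obtain N where N: "\<And>j. j \<ge> N \<Longrightarrow> norm q ^ Suc j * norm z < 1 / 2"
    by (auto simp: eventually_sequentially)
  show ?thesis
  proof (rule summable_ratio_test[where c = "1 / 2" and N = N])
    fix n assume "n \<ge> N"
    have e: "Suc n * (Suc n + 1) div 2 = n * (n + 1) div 2 + Suc n"
    proof -
      have "Suc n * (Suc n + 1) = n * (n + 1) + Suc n * 2" by (simp add: algebra_simps)
      thus ?thesis by simp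
    qed
    have "norm (q ^ (Suc n * (Suc n + 1) div 2) * z ^ Suc n) =
        (norm q ^ Suc n * norm z) * norm (q ^ (n * (n + 1) div 2) * z ^ n)"
      unfolding e power_add by (simp add: norm_mult norm_power)
    also have "\<dots> \<le> 1 / 2 * norm (q ^ (n * (n + 1) div 2) * z ^ n)"
      using N[OF \<open>n \<ge> N\<close>] by (intro mult_right_mono) auto
    finally show "norm (q ^ (Suc n * (Suc n + 1) div 2) * z ^ Suc n)
        \<le> 1 / 2 * norm (q ^ (n * (n + 1) div 2) * z ^ n)" .
  qed simp
qed

lemma partial_theta_holomorphic:
  assumes "norm q < 1"
  shows "partial_theta q holomorphic_on A"
proof -
  have "((\<lambda>z. \<Sum>j. q ^ (j * (j + 1) div 2) * z ^ j) has_field_derivative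
      (\<Sum>j. diffs (\<lambda>j. q ^ (j * (j + 1) div 2)) j * z ^ j)) (at z)" for z
    by (rule termdiffs_strong_converges_everywhere) (rule summable_partial_theta[OF assms])
  hence "partial_theta q field_differentiable (at z)" for z
    unfolding field_differentiable_def partial_theta_def[abs_def] by blast
  thus ?thesis
    by (auto simp: holomorphic_on_def intro: field_differentiable_at_within)
qed

lemma partial_theta_0 [simp]: "partial_theta q 0 = 1"
  using powser_zero[of "\<lambda>j. q ^ (j * (j + 1) div 2)"] by (simp add: partial_theta_def)

lemma zorder_partial_theta_pos:
  assumes "norm q < 1" "partial_theta q z = 0"
  shows "zorder (partial_theta q) z > 0"
proof -
  have "\<exists>w\<in>UNIV. partial_theta q w \<noteq> 0"
    by (rule bexI[of _ 0]) auto
  thus ?thesis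
    using zorder_exist_zero[OF partial_theta_holomorphic[OF assms(1)], of UNIV z] assms(2)
    by (auto simp: Let_def)
qed

(* For k0 = 1 no zeros remain, so the xi_k are all the zeros. *)
lemma strongly_separated_iff:
  assumes "norm q < 1"
  shows "strongly_separated q \<longleftrightarrow>
    (\<exists>\<xi>. only_simple_zero_in (partial_theta q) (theta_disk q (3 / 2)) (\<xi> 1) \<and>
      (\<forall>k\<ge>2. only_simple_zero_in (partial_theta q)
        (theta_annulus q (real k - 1 / 2) (real k + 1 / 2)) (\<xi> k)) \<and>
      {z. partial_theta q z = 0} = \<xi> ` {1..})"
    (is "_ \<longleftrightarrow> (\<exists>\<xi>. ?A \<xi> \<and> ?B \<xi> \<and> ?C \<xi>)")
proof -
  let ?f = "partial_theta q"
  have AB: "(\<forall>k\<ge>1. only_simple_zero_in ?f (theta_region q k) (\<xi> k)) \<longleftrightarrow> ?A \<xi> \<and> ?B \<xi>" for \<xi>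
  proof
    assume *: "\<forall>k\<ge>1. only_simple_zero_in ?f (theta_region q k) (\<xi> k)"
    have "?A \<xi>" using *[rule_format, of 1] by (simp add: theta_region_def)
    moreover have "?B \<xi>"
    proof (intro allI impI)
      fix k :: nat assume "k \<ge> 2"
      thus "only_simple_zero_in ?f (theta_annulus q (real k - 1 / 2) (real k + 1 / 2)) (\<xi> k)"
        using *[rule_format, of k] by (simp add: theta_region_def)
    qed
    ultimately show "?A \<xi> \<and> ?B \<xi>" ..
  qed (auto simp: theta_region_def)
  have R: "has_zero_count ?f (- X) 0 \<longleftrightarrow> zeros_in ?f (- X) = {}" for X
  proof
    assume "has_zero_count ?f (- X) 0"
    hence fin: "finite (zeros_in ?f (- X))" and s: "(\<Sum>z\<in>zeros_in ?f (- X). zorder ?f z) = 0"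
      by (simp_all add: has_zero_count_def)
    have pos: "zorder ?f z > 0" if "z \<in> zeros_in ?f (- X)" for z
      using that zorder_partial_theta_pos[OF assms] by (simp add: zeros_in_def)
    show "zeros_in ?f (- X) = {}"
      using sum_pos[OF fin _ pos] s by fastforce
  qed (simp add: has_zero_count_def)
  have C: "zeros_in ?f (- (\<xi> ` {1..})) = {} \<longleftrightarrow> ?C \<xi>" if "?A \<xi> \<and> ?B \<xi>" for \<xi>
  proof -
    have "?f (\<xi> k) = 0" if "k \<ge> 1" for k
      using \<open>?A \<xi> \<and> ?B \<xi>\<close>[folded AB] that by (auto simp: only_simple_zero_in_def zeros_in_def)
    thus ?thesis by (auto simp: zeros_in_def)
  qed
  show ?thesis
    unfolding strongly_separated_def strongly_separated_from_def AB diff_self_eq_0 R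
    using C by auto
qed

end

theory Submission
  imports Defs
begin

text \<open>
  Write \<open>q = p\<^sup>2\<close> with \<open>Im p > 0\<close> and \<open>e = p / |p|\<close>. On the circle \<open>|z| = |q|\<^bsup>-k-1/2\<^esup>\<close>, with
  \<open>w = z p\<^bsup>2k+1\<^esup>\<close>, the function \<open>\<theta>(q,z) / z\<^bsup>k\<^esup>\<close> is a constant multiple of the sum \<open>G\<close> of \<open>p\<^bsup>m\<^sup>2\<^esup> w\<^bsup>m\<^esup>\<close>
  over \<open>m \<ge> -k\<close>. Since \<open>|w| = 1\<close>, the terms \<open>m = 1\<close> and \<open>m = -1\<close> add up to a real multiple of \<open>p\<close>,
  so they do not contribute to the real part of \<open>\<i> cnj e G\<close>. What remains is \<open>Im e\<close>, which is
  at least \<open>1 / sqrt 2\<close> because \<open>Re q \<le> 0\<close>, plus terms that are small for \<open>|q| \<le> 0.6\<close>.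
  Hence \<open>\<theta>(q,z) / z\<^bsup>k\<^esup>\<close> stays in an open half plane on that circle, and Rouche's theorem gives
  exactly \<open>k\<close> zeros inside. This works for all \<open>k \<ge> 1\<close>, so strong separation holds
  on the whole sector of radius \<open>0.6\<close>, and part (2) is a consequence.
\<close>

section \<open>Counting zeros inside a circle by Rouche's theorem\<close>

text \<open>On the circle, the values of \<open>\<mu> f(z) / z\<^bsup>k\<^esup>\<close> form a compact subset of the open right half plane, so
  they lie in the disc around \<open>M\<close> of radius \<open>M\<close> for large \<open>M\<close>: compare \<open>f\<close> with \<open>(M/\<mu>) z\<^bsup>k\<^esup>\<close>.\<close>
lemma zero_count_ball:
  fixes f :: "complex \<Rightarrow> complex"
  assumes f: "f holomorphic_on UNIV" and R: "R > 0"
    and pos: "\<And>z. norm z = R \<Longrightarrow> Re (\<mu> * f z / z ^ k) > 0"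
  shows "has_zero_count f (ball 0 R) k"
proof -
  define h where "h z = \<mu> * f z / z ^ k" for z
  have "continuous_on (sphere 0 R) f"
    using f holomorphic_on_imp_continuous_on continuous_on_subset by blast
  hence h: "continuous_on (sphere 0 R) h"
    unfolding h_def using R by (intro continuous_intros) auto
  \<comment> \<open>|h - M| < M unfolds to |h|^2 < 2 M Re h, so \<open>M\<close> only has to exceed
    this quotient, which is bounded on the compact circle.\<close>
  have "continuous_on (sphere 0 R) (\<lambda>z. (norm (h z))\<^sup>2 / (2 * Re (h z)))"
    using pos by (intro continuous_intros h) (fastforce simp: h_def)
  hence "bounded ((\<lambda>z. (norm (h z))\<^sup>2 / (2 * Re (h z))) ` sphere 0 R)"
    by (intro compact_imp_bounded compact_continuous_image) auto
  then obtain M where M: "M > 0" "\<And>z. norm z = R \<Longrightarrow> (norm (h z))\<^sup>2 / (2 * Re (h z)) < M"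
    unfolding bounded_pos_less by (auto simp: abs_less_iff)
  have near: "norm (h z - of_real M) < M" if "norm z = R" for z
  proof -
    have "(norm (h z))\<^sup>2 < M * (2 * Re (h z))"
      using M(2)[OF that] pos[OF that] by (simp add: h_def pos_divide_less_eq)
    hence "(norm (h z - of_real M))\<^sup>2 < M\<^sup>2"
      by (simp add: cmod_power2) (simp add: power2_eq_square algebra_simps)
    thus ?thesis using M(1) by (simp add: power2_less_imp_less)
  qed
  have "\<mu> \<noteq> 0" using pos[of "of_real R"] R by auto
  define c where "c = of_real M / \<mu>"
  have "c \<noteq> 0" using M(1) \<open>\<mu> \<noteq> 0\<close> by (simp add: c_def)
  have less: "norm (f z - c * z ^ k) < norm (c * z ^ k)" if "norm z = R" for z
  proof -
    have z: "z \<noteq> 0" using that R by auto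
    have "f z - c * z ^ k = z ^ k / \<mu> * (h z - of_real M)"
      using z \<open>\<mu> \<noteq> 0\<close> by (simp add: h_def c_def field_simps)
    hence "norm (f z - c * z ^ k) = norm (z ^ k / \<mu>) * norm (h z - of_real M)"
      by (simp only: norm_mult)
    also have "\<dots> < norm (z ^ k / \<mu>) * M"
      using near[OF that] z \<open>\<mu> \<noteq> 0\<close> by (intro mult_strict_left_mono) auto
    also have "\<dots> = norm (c * z ^ k)"
      using M(1) by (simp add: c_def norm_mult norm_divide)
    finally show ?thesis .
  qed
  \<comment> \<open>An open connected neighbourhood of the closed disc, as Rouche's theorem
    requires; the margin 1 is arbitrary.\<close>
  define S where "S = ball (0::complex) (R + 1)"
  have fz: "f z \<noteq> 0" if "norm z = R" for z
    using pos[OF that] by auto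
  \<comment> \<open>\<open>f\<close> is nonzero on the circle, so a zero anywhere makes it
    nonconstant, and then its zeros in a compact set are finite in number.\<close>
  have nc: "\<not> f constant_on UNIV" if "f w = 0" for w
    using that fz[of "of_real R"] R unfolding constant_on_def by (metis UNIV_I abs_of_pos norm_of_real)
  have fin: "finite {z \<in> cball 0 (R + 1). f z = 0}"
  proof (cases "\<exists>w. f w = 0")
    case True
    thus ?thesis using nc by (intro holomorphic_compact_finite_zeros[OF f]) auto
  next
    case False
    hence "{z \<in> cball 0 (R + 1). f z = 0} = {}" by auto
    thus ?thesis by (simp only: finite.emptyI)
  qed
  have finS: "finite {p \<in> S. f p = 0}"
    by (rule finite_subset[OF _ fin]) (auto simp: S_def)
  have finB: "finite (zeros_in f (ball 0 R))"
    by (rule finite_subset[OF _ fin]) (auto simp: zeros_in_def)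
  have Z: "{p \<in> S. c * p ^ k = 0} = (if k = 0 then {} else {0})"
    using \<open>c \<noteq> 0\<close> R by (auto simp: S_def)
  have "(\<Sum>p\<in>{p \<in> S. c * p ^ k + (f p - c * p ^ k) = 0}.
           winding_number (circlepath 0 R) p * of_int (zorder (\<lambda>p. c * p ^ k + (f p - c * p ^ k)) p)) =
        (\<Sum>p\<in>{p \<in> S. c * p ^ k = 0}. winding_number (circlepath 0 R) p * of_int (zorder (\<lambda>p. c * p ^ k) p))"
  proof (rule Rouche_theorem)
    show "open S" "connected S" by (auto simp: S_def)
    show "finite {p \<in> S. c * p ^ k + (f p - c * p ^ k) = 0}" using finS by simp
    show "finite {p \<in> S. c * p ^ k = 0}" unfolding Z by simp
    show "(\<lambda>p. c * p ^ k) holomorphic_on S" by (intro holomorphic_intros)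
    show "(\<lambda>p. f p - c * p ^ k) holomorphic_on S"
      by (intro holomorphic_intros holomorphic_on_subset[OF f]) auto
    show "valid_path (circlepath 0 R)" "pathfinish (circlepath 0 R) = pathstart (circlepath 0 R)"
      by auto
    show "path_image (circlepath 0 R) \<subseteq> S" using R by (auto simp: S_def)
    show "\<forall>z\<in>path_image (circlepath 0 R). cmod (f z - c * z ^ k) < cmod (c * z ^ k)"
      using less R by (auto simp: path_image_circlepath)
    show "\<forall>z. z \<notin> S \<longrightarrow> winding_number (circlepath 0 R) z = 0"
      using R by (auto simp: S_def intro!: winding_number_zero_outside[of _ "cball 0 R"])
  qed
  hence "(\<Sum>p\<in>{p \<in> S. f p = 0}. winding_number (circlepath 0 R) p * of_int (zorder f p)) =
        (\<Sum>p\<in>{p \<in> S. c * p ^ k = 0}. winding_number (circlepath 0 R) p * of_int (zorder (\<lambda>p. c * p ^ k) p))"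
    by simp
  also have "\<dots> = of_nat k"
  proof (cases "k = 0")
    case False
    have "zorder (\<lambda>p. c * p ^ k) 0 = int k"
      by (rule zorder_eqI[of UNIV _ "\<lambda>_. c"]) (use \<open>c \<noteq> 0\<close> in \<open>auto simp: power_int_of_nat\<close>)
    thus ?thesis unfolding Z using False R by (simp add: winding_number_circlepath_centre)
  next
    case True
    thus ?thesis unfolding Z by simp
  qed
  \<comment> \<open>Zeros outside the circle have winding number 0 and none lies on it, so only the
    ball contributes, with winding number 1.\<close>
  also have "(\<Sum>p\<in>{p \<in> S. f p = 0}. winding_number (circlepath 0 R) p * of_int (zorder f p)) =
      (\<Sum>p\<in>zeros_in f (ball 0 R). winding_number (circlepath 0 R) p * of_int (zorder f p))"
  proof (intro sum.mono_neutral_right finS ballI)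
    show "zeros_in f (ball 0 R) \<subseteq> {p \<in> S. f p = 0}" by (auto simp: zeros_in_def S_def)
    fix p assume p: "p \<in> {p \<in> S. f p = 0} - zeros_in f (ball 0 R)"
    hence "norm p > R" using fz[of p] by (force simp: zeros_in_def)
    hence "winding_number (circlepath 0 R) p = 0"
      using R by (intro winding_number_zero_outside[of _ "cball 0 R"]) auto
    thus "winding_number (circlepath 0 R) p * of_int (zorder f p) = 0" by simp
  qed
  also have "\<dots> = (\<Sum>p\<in>zeros_in f (ball 0 R). of_int (zorder f p))"
    by (intro sum.cong refl) (simp add: zeros_in_def winding_number_circlepath)
  also have "\<dots> = of_int (\<Sum>p\<in>zeros_in f (ball 0 R). zorder f p)" by simp
  finally have "of_int (\<Sum>p\<in>zeros_in f (ball 0 R). zorder f p) = (of_int (int k) :: complex)"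
    by simp
  hence "(\<Sum>p\<in>zeros_in f (ball 0 R). zorder f p) = int k"
    using of_int_eq_iff by blast
  thus ?thesis using finB by (simp add: has_zero_count_def)
qed

lemma has_zero_count_diff:
  assumes "has_zero_count f A m" "has_zero_count f B n"
    and "zeros_in f A \<subseteq> zeros_in f B" "zeros_in f C = zeros_in f B - zeros_in f A" "m \<le> n"
  shows "has_zero_count f C (n - m)"
  using assms by (auto simp: has_zero_count_def sum_diff of_nat_diff)

text \<open>Every zero adds at least 1 to the count, so a total of 1 leaves room for one zero of
  order 1.\<close>

lemma only_simple_zero_in_if_count_1:
  assumes "has_zero_count f S 1" "\<And>z. f z = 0 \<Longrightarrow> zorder f z > 0"
  shows "\<exists>w. only_simple_zero_in f S w"
proof -
  let ?Z = "zeros_in f S"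
  have fin: "finite ?Z" and s: "(\<Sum>z\<in>?Z. zorder f z) = 1"
    using assms(1) by (simp_all add: has_zero_count_def)
  have ge: "zorder f z \<ge> 1" if "z \<in> ?Z" for z
    using assms(2)[of z] that by (simp add: zeros_in_def)
  have "?Z \<noteq> {}" using s by auto
  then obtain w where w: "w \<in> ?Z" by blast
  have "1 = zorder f w + (\<Sum>z\<in>?Z - {w}. zorder f z)"
    using s fin w by (simp add: sum.remove)
  moreover have "(\<Sum>z\<in>?Z - {w}. zorder f z) \<ge> (\<Sum>z\<in>?Z - {w}. 1)"
    using ge by (intro sum_mono) auto
  ultimately have "card (?Z - {w}) = 0" "zorder f w = 1"
    using ge[OF w] by auto
  moreover from this have "?Z = {w}" using fin w by (simp only: card_0_eq[OF finite_Diff]) blast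
  ultimately show ?thesis by (auto simp: only_simple_zero_in_def)
qed

section \<open>Series with square exponents and the rescaling of theta\<close>

text \<open>As m^2 >= m for natural m, (m + N)^2 >= N^2 + (2 N + 1) m, so a geometric series of
  ratio s^(2 N + 1) dominates the tail.\<close>

lemma square_powers_tail:
  fixes s :: real
  assumes "0 \<le> s" "s < 1"
  shows "summable (\<lambda>m. s ^ (m + N)\<^sup>2)"
    and "(\<Sum>m. s ^ (m + N)\<^sup>2) \<le> s ^ N\<^sup>2 / (1 - s ^ (2 * N + 1))"
proof -
  define x where "x = s ^ (2 * N + 1)"
  have x: "0 \<le> x" "x < 1"
    using assms power_Suc_less_one[of s "2 * N"] by (cases "s = 0"; simp add: x_def)+
  have le: "s ^ (m + N)\<^sup>2 \<le> s ^ N\<^sup>2 * x ^ m" for m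
  proof -
    have "N\<^sup>2 + (2 * N + 1) * m \<le> (m + N)\<^sup>2"
      by (simp add: power2_eq_square algebra_simps)
    hence "s ^ (m + N)\<^sup>2 \<le> s ^ (N\<^sup>2 + (2 * N + 1) * m)"
      using assms by (intro power_decreasing) auto
    thus ?thesis by (simp only: x_def power_add power_mult)
  qed
  have g: "summable (\<lambda>m. s ^ N\<^sup>2 * x ^ m)"
    using x by (intro summable_mult summable_geometric) auto
  show sm: "summable (\<lambda>m. s ^ (m + N)\<^sup>2)"
    by (rule summable_comparison_test'[OF g, of 0]) (use le assms in auto)
  have "(\<Sum>m. s ^ (m + N)\<^sup>2) \<le> (\<Sum>m. s ^ N\<^sup>2 * x ^ m)"
    by (intro suminf_le le sm g)
  also have "\<dots> = s ^ N\<^sup>2 / (1 - x)"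
    using x by (subst suminf_mult) (auto simp: suminf_geometric summable_geometric)
  finally show "(\<Sum>m. s ^ (m + N)\<^sup>2) \<le> s ^ N\<^sup>2 / (1 - s ^ (2 * N + 1))"
    by (simp only: x_def)
qed

text \<open>Completing the square around index k: for j = k + m, j^2 + j = (k^2 + k) + (2 k + 1) m +
  m^2, and \<open>w\<close> absorbs the part linear in m. For negative m, |w| = 1 turns the inverse
  of \<open>w\<close> into \<open>cnj w\<close>.\<close>

lemma partial_theta_rescaled:
  fixes p z :: complex
  assumes p: "norm p < 1" and w: "w = z * p ^ (2 * k + 1)" "norm w = 1"
  shows "partial_theta (p\<^sup>2) z = p ^ (k\<^sup>2 + k) * z ^ k *
    ((\<Sum>m. p ^ m\<^sup>2 * w ^ m) + (\<Sum>m=1..k. p ^ m\<^sup>2 * cnj w ^ m))"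
proof -
  define t where "t j = p ^ (j\<^sup>2 + j) * z ^ j" for j
  define C where "C = p ^ (k\<^sup>2 + k) * z ^ k"
  have t: "(p\<^sup>2) ^ (j * (j + 1) div 2) * z ^ j = t j" for j
  proof -
    have "2 * (j * (j + 1) div 2) = j\<^sup>2 + j" by (simp add: power2_eq_square)
    thus ?thesis by (simp only: t_def power_mult[symmetric])
  qed
  have q: "norm (p\<^sup>2) < 1"
    using p by (simp add: norm_power power_less_one_iff abs_square_less_1)
  have sm: "summable t"
    using summable_partial_theta[OF q, of z] by (simp only: t)
  have hi: "t (m + k) = C * (p ^ m\<^sup>2 * w ^ m)" for m
  proof -
    have e: "(m + k)\<^sup>2 + (m + k) = (k\<^sup>2 + k) + (m\<^sup>2 + (2 * k + 1) * m)"
      by (simp add: power2_eq_square algebra_simps)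
    have "p ^ ((m + k)\<^sup>2 + (m + k)) = p ^ (k\<^sup>2 + k) * (p ^ m\<^sup>2 * (p ^ (2 * k + 1)) ^ m)"
      by (simp only: e power_add[of p "k\<^sup>2 + k"] power_add[of p "m\<^sup>2"] power_mult)
    hence "t (m + k) = p ^ (k\<^sup>2 + k) * (p ^ m\<^sup>2 * (p ^ (2 * k + 1)) ^ m) * (z ^ m * z ^ k)"
      by (simp only: t_def power_add[of z])
    also have "\<dots> = C * (p ^ m\<^sup>2 * w ^ m)"
      unfolding C_def w(1) power_mult_distrib by (simp only: mult_ac)
    finally show ?thesis .
  qed
  have ww: "w * cnj w = 1"
    using complex_norm_square[of w] w(2) by simp
  have lo: "t (k - m) = C * (p ^ m\<^sup>2 * cnj w ^ m)" if "m \<le> k" for m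
  proof -
    define j where "j = k - m"
    have j: "k = j + m" using that by (simp add: j_def)
    have e: "(j\<^sup>2 + j) + (2 * k + 1) * m = (k\<^sup>2 + k) + m\<^sup>2"
      by (simp add: j power2_eq_square algebra_simps)
    have "p ^ (j\<^sup>2 + j) * (p ^ (2 * k + 1)) ^ m = p ^ (k\<^sup>2 + k) * p ^ m\<^sup>2"
      by (simp only: e power_add[symmetric] power_mult[symmetric])
    moreover have "z ^ j * z ^ m = z ^ k" by (simp only: j power_add)
    \<comment> \<open>Exponents are natural numbers, so the identity is first obtained with the
      extra factor \<open>w ^ m\<close>, which \<open>cnj w ^ m\<close> then removes.\<close>
    moreover have "t j * w ^ m = (p ^ (j\<^sup>2 + j) * (p ^ (2 * k + 1)) ^ m) * (z ^ j * z ^ m)"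
      unfolding t_def w(1) power_mult_distrib by (simp only: mult_ac)
    ultimately have "t j * w ^ m = C * p ^ m\<^sup>2"
      unfolding C_def by (simp only: mult_ac)
    hence "t j * (w * cnj w) ^ m = C * (p ^ m\<^sup>2 * cnj w ^ m)"
      by (simp only: power_mult_distrib mult.assoc[symmetric])
    thus ?thesis by (simp add: ww j_def)
  qed
  have "summable (\<lambda>m. C * (p ^ m\<^sup>2 * w ^ m))"
    using sm by (simp only: hi[symmetric] summable_iff_shift)
  \<comment> \<open>|w| = 1 forces \<open>p\<close> and \<open>z\<close> to be nonzero.\<close>
  moreover have "C \<noteq> 0"
    using w p by (auto simp: C_def)
  ultimately have sm': "summable (\<lambda>m. p ^ m\<^sup>2 * w ^ m)"
    by (simp add: summable_cmult_iff)
  have "partial_theta (p\<^sup>2) z = suminf t"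
    unfolding partial_theta_def t ..
  also have "\<dots> = (\<Sum>m. t (m + k)) + sum t {..<k}"
    by (rule suminf_split_initial_segment[OF sm])
  also have "(\<Sum>m. t (m + k)) = C * (\<Sum>m. p ^ m\<^sup>2 * w ^ m)"
    unfolding hi by (rule suminf_mult[OF sm'])
  also have "sum t {..<k} = (\<Sum>m=1..k. t (k - m))"
    by (rule sum.reindex_bij_witness[of _ "\<lambda>m. k - m" "\<lambda>j. k - j"]) auto
  also have "\<dots> = C * (\<Sum>m=1..k. p ^ m\<^sup>2 * cnj w ^ m)"
    unfolding sum_distrib_left by (intro sum.cong refl) (simp add: lo)
  finally show ?thesis by (simp add: C_def distrib_left)
qed

section \<open>Lower bounds in the rotated half plane\<close>

text \<open>For 1 <= m < N the terms of index m and -m are paired: \<open>w ^ m + cnj w ^ m\<close>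
  is real, so only the direction of p^(m^2) matters, and the pair m = 1 contributes 0.
  \<open>N \<le> k + 1\<close> guarantees that both members of each pair occur. All other terms
  except m = 0 are bounded by their norms.\<close>

lemma symmetric_series_core_estimate:
  fixes e w :: complex
  assumes p: "p = of_real s * e" and e: "norm e = 1" and w: "norm w = 1"
    and s: "0 < s" "s < 1" and N: "1 \<le> N" "N \<le> k + 1"
  shows "Re (\<i> * cnj e * ((\<Sum>m. p ^ m\<^sup>2 * w ^ m) + (\<Sum>m=1..k. p ^ m\<^sup>2 * cnj w ^ m))) \<ge>
    Im e + (\<Sum>m=1..<N. 2 * s ^ m\<^sup>2 * Re (w ^ m) * Re (\<i> * e ^ (m\<^sup>2 - 1)))
      - (\<Sum>m. s ^ (m + N)\<^sup>2) - (\<Sum>m=N..k. s ^ m\<^sup>2)"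
proof -
  \<comment> \<open>Real-linear, zero on real multiples of \<open>e\<close>, and bounded by the norm
    since the multiplier has modulus 1.\<close>
  define U where "U X = Re (\<i> * cnj e * X)" for X
  let ?t = "\<lambda>m. p ^ m\<^sup>2 * w ^ m" and ?u = "\<lambda>m. p ^ m\<^sup>2 * cnj w ^ m"
  have U_add: "U (X + Y) = U X + U Y" for X Y
    by (simp add: U_def algebra_simps)
  have U_sum: "U (\<Sum>m\<in>I. f m) = (\<Sum>m\<in>I. U (f m))" for I and f :: "nat \<Rightarrow> complex"
    by (simp only: U_def sum_distrib_left Re_sum)
  have U_ge: "U X \<ge> - norm X" for X
    using abs_Re_le_cmod[of "\<i> * cnj e * X"] e by (simp add: U_def norm_mult)
  have np: "norm p = s" using s e by (simp add: p norm_mult)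
  have nt: "norm (?t m) = s ^ m\<^sup>2" "norm (?u m) = s ^ m\<^sup>2" for m
    using w by (simp_all add: norm_mult norm_power np)
  have "summable (\<lambda>m. norm (?t (m + 0)))"
    unfolding nt by (rule square_powers_tail) (use s in auto)
  hence sm: "summable (\<lambda>m. norm (?t m))" by simp
  have "summable (\<lambda>m. norm (?t (m + N)))"
    unfolding nt by (rule square_powers_tail) (use s in auto)
  from summable_norm[OF this] have tail: "norm (\<Sum>m. ?t (m + N)) \<le> (\<Sum>m. s ^ (m + N)\<^sup>2)"
    unfolding nt .
  have gap: "norm (\<Sum>m=N..k. ?u m) \<le> (\<Sum>m=N..k. s ^ m\<^sup>2)"
    using norm_sum[of ?u "{N..k}"] unfolding nt .
  have "(\<Sum>m. ?t m) = (\<Sum>m. ?t (m + N)) + (\<Sum>m<N. ?t m)"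
    by (rule suminf_split_initial_segment[OF summable_norm_cancel[OF sm]])
  moreover have "(\<Sum>m<N. ?t m) = 1 + (\<Sum>m=1..<N. ?t m)"
  proof -
    have "{..<N} = insert 0 {1..<N}" using N by auto
    thus ?thesis by simp
  qed
  moreover have "(\<Sum>m=1..k. ?u m) = (\<Sum>m=1..<N. ?u m) + (\<Sum>m=N..k. ?u m)"
  proof -
    have "{1..k} = {1..<N} \<union> {N..k}" using N by auto
    thus ?thesis by (simp only:) (rule sum.union_disjoint; auto)
  qed
  ultimately have "(\<Sum>m. ?t m) + (\<Sum>m=1..k. ?u m) =
      1 + (\<Sum>m=1..<N. ?t m + ?u m) + (\<Sum>m. ?t (m + N)) + (\<Sum>m=N..k. ?u m)"
    by (simp add: sum.distrib)
  hence "U ((\<Sum>m. ?t m) + (\<Sum>m=1..k. ?u m)) =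
      U 1 + (\<Sum>m=1..<N. U (?t m + ?u m)) + U (\<Sum>m. ?t (m + N)) + U (\<Sum>m=N..k. ?u m)"
    by (simp only: U_add U_sum)
  moreover have "U 1 = Im e" by (simp add: U_def)
  moreover have "U (?t m + ?u m) = 2 * s ^ m\<^sup>2 * Re (w ^ m) * Re (\<i> * e ^ (m\<^sup>2 - 1))"
    if "m \<in> {1..<N}" for m
  proof -
    have "w ^ m + cnj w ^ m = of_real (2 * Re (w ^ m))"
      using complex_add_cnj[of "w ^ m"] by simp
    \<comment> \<open>Here m >= 1, so the truncated subtraction is exact.\<close>
    moreover have "cnj e * e ^ m\<^sup>2 = e ^ (m\<^sup>2 - 1)"
    proof -
      have "e ^ m\<^sup>2 = e * e ^ (m\<^sup>2 - 1)"
        using that by (simp add: power_eq_if[of e "m\<^sup>2"])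
      moreover have "cnj e * e = 1"
        using complex_norm_square[of e] e by (simp add: mult.commute)
      ultimately show ?thesis by (simp add: mult.assoc[symmetric])
    qed
    moreover have "\<i> * cnj e * (?t m + ?u m) =
        of_real (s ^ m\<^sup>2) * (w ^ m + cnj w ^ m) * (\<i> * (cnj e * e ^ m\<^sup>2))"
      by (simp add: p power_mult_distrib algebra_simps)
    ultimately have "\<i> * cnj e * (?t m + ?u m) =
        of_real (2 * s ^ m\<^sup>2 * Re (w ^ m)) * (\<i> * e ^ (m\<^sup>2 - 1))"
      by simp
    thus ?thesis by (simp only: U_def scaleR_conv_of_real[symmetric] scaleR_complex.sel)
  qed
  hence "(\<Sum>m=1..<N. U (?t m + ?u m)) =
      (\<Sum>m=1..<N. 2 * s ^ m\<^sup>2 * Re (w ^ m) * Re (\<i> * e ^ (m\<^sup>2 - 1)))"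
    by (intro sum.cong refl)
  ultimately show ?thesis
    using U_ge[of "\<Sum>m. ?t (m + N)"] U_ge[of "\<Sum>m=N..k. ?u m"] tail gap
    unfolding U_def[symmetric] by linarith
qed

text \<open>The core estimate is applied with N = min (k + 1) 4: pairs up to m = 3 are kept, the
  rest is absorbed by tail bounds.\<close>

lemma symmetric_series_positive:
  fixes e w :: complex
  assumes p: "p = of_real s * e" and e: "norm e = 1" and w: "norm w = 1"
    and s: "0 < s" "s\<^sup>2 \<le> 0.6" and k: "k \<ge> 1"
    and pos: "Im e > 0" and AB: "(Re e)\<^sup>2 \<le> (Im e)\<^sup>2"
  shows "Re (\<i> * cnj e * ((\<Sum>m. p ^ m\<^sup>2 * w ^ m) + (\<Sum>m=1..k. p ^ m\<^sup>2 * cnj w ^ m))) > 0"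
    (is "Re (?u * ?G) > 0")
proof -
  define A B where "A = Re e" and "B = Im e"
  have AB1: "A\<^sup>2 + B\<^sup>2 = 1" using e by (simp add: A_def B_def cmod_power2[symmetric])
  have B: "B > 0" using pos by (simp add: B_def)
  have A2: "A\<^sup>2 \<le> 1 / 2" and B2: "B\<^sup>2 \<ge> 1 / 2" using AB AB1 by (auto simp: A_def B_def)
  \<comment> \<open>0.707 lies below 1 / sqrt 2 and 0.7746 above sqrt 0.6. Even powers of
    \<open>s\<close> are bounded by powers of 0.6; odd ones take one further factor 0.7746.\<close>
  have B7: "B \<ge> 0.707"
    by (rule power2_le_imp_le) (use B2 B in \<open>auto simp: power2_eq_square\<close>)
  have s1: "s \<le> 0.7746"
    by (rule power2_le_imp_le) (use s in \<open>auto simp: power2_eq_square\<close>)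
  have s4: "s ^ 4 \<le> 0.36"
    using power_mono[of "s\<^sup>2" "0.6" 2] s by (simp add: power_mult[symmetric] power_numeral_reduce)
  have s16: "s ^ 16 \<le> 0.0168"
    using power_mono[of "s\<^sup>2" "0.6" 8] s by (simp add: power_mult[symmetric] power_numeral_reduce)
  have s8: "s ^ 8 \<le> 0.1296"
    using power_mono[of "s\<^sup>2" "0.6" 4] s by (simp add: power_mult[symmetric] power_numeral_reduce)
  have s6: "s ^ 6 \<le> 0.216"
    using power_mono[of "s\<^sup>2" "0.6" 3] s by (simp add: power_mult[symmetric] power_numeral_reduce)
  have s5: "s ^ 5 \<le> 0.279" using mult_mono[OF s4 s1] s by (simp add: power_numeral_reduce)
  have s9: "s ^ 9 \<le> 0.1004" using mult_mono[OF s8 s1] s by (simp add: power_numeral_reduce)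
  have s7: "s ^ 7 \<le> 0.1674" using mult_mono[OF s6 s1] s by (simp add: power_numeral_reduce)
  have Rw: "\<bar>Re (w ^ m)\<bar> \<le> 1" for m
    using abs_Re_le_cmod[of "w ^ m"] w by (simp add: norm_power)
  have e4: "Re (\<i> * e ^ 3) = - B * (4 * A\<^sup>2 - 1)"
  proof -
    have "Re (\<i> * e ^ 3) = - (3 * A\<^sup>2 * B - B ^ 3)"
      by (simp add: A_def B_def power_numeral_reduce algebra_simps)
    also have "\<dots> = - B * (3 * A\<^sup>2 - B\<^sup>2)"
      by (simp add: power_numeral_reduce algebra_simps)
    also have "3 * A\<^sup>2 - B\<^sup>2 = 4 * A\<^sup>2 - 1" using AB1 by simp
    finally show ?thesis .
  qed
  \<comment> \<open>\<open>x4\<close> and \<open>x9\<close> are the pairs m = 2 and m = 3, named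
    after m^2. \<open>D\<close> and \<open>E\<close> are their angular factors after splitting off
    \<open>B\<close>; below, 0.72 = 2 * 0.36 and 1.6064 = 2 * 0.1004 * 8.\<close>
  define D E where "D = \<bar>4 * A\<^sup>2 - 1\<bar>" and "E = \<bar>A\<bar> * (1 - 2 * A\<^sup>2)"
  define x4 x9 where "x4 = 2 * s ^ 4 * Re (w\<^sup>2) * Re (\<i> * e ^ 3)"
    and "x9 = 2 * s ^ 9 * Re (w ^ 3) * Re (\<i> * e ^ 8)"
  have E0: "E \<ge> 0" using A2 by (simp add: E_def)
  have X4: "x4 \<ge> - 0.72 * (B * D)"
  proof -
    have "\<bar>x4\<bar> = 2 * s ^ 4 * \<bar>Re (w\<^sup>2)\<bar> * (B * D)"
      using B s by (simp only: x4_def e4 abs_mult D_def) simp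
    also have "\<dots> \<le> 2 * 0.36 * 1 * (B * D)"
      using s4 Rw[of 2] B s by (intro mult_right_mono mult_mono) (auto simp: D_def)
    finally show ?thesis by linarith
  qed
  \<comment> \<open>The angle is doubled repeatedly from \<open>e\<close> to \<open>e ^ 8\<close>;
    of the resulting factors only \<open>Re (e ^ 4)\<close> is estimated, by 1.\<close>
  have e8: "\<bar>Re (\<i> * e ^ 8)\<bar> \<le> 8 * (B * E)"
  proof -
    have i: "Im (x\<^sup>2) = 2 * Re x * Im x" and r: "Re (x\<^sup>2) = (Re x)\<^sup>2 - (Im x)\<^sup>2" for x
      by (simp_all add: power2_eq_square)
    have "Im (e ^ 4) = 2 * (A\<^sup>2 - B\<^sup>2) * (2 * A * B)"
      using i[of "e\<^sup>2"] by (simp add: i r A_def B_def power_mult[symmetric])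
    hence "Im (e ^ 8) = 2 * Re (e ^ 4) * (2 * (A\<^sup>2 - B\<^sup>2) * (2 * A * B))"
      using i[of "e ^ 4"] by (simp add: power_mult[symmetric])
    hence "Re (\<i> * e ^ 8) = - (2 * Re (e ^ 4) * (2 * (A\<^sup>2 - B\<^sup>2) * (2 * A * B)))"
      by simp
    also have "A\<^sup>2 - B\<^sup>2 = - (1 - 2 * A\<^sup>2)" using AB1 by simp
    finally have "\<bar>Re (\<i> * e ^ 8)\<bar> = \<bar>Re (e ^ 4)\<bar> * (8 * (B * E))"
      using B A2 by (simp add: abs_mult E_def)
    also have "\<dots> \<le> 1 * (8 * (B * E))"
      using abs_Re_le_cmod[of "e ^ 4"] e B E0 by (intro mult_right_mono) (auto simp: norm_power)
    finally show ?thesis by simp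
  qed
  have X9: "x9 \<ge> - 1.6064 * (B * E)"
  proof -
    have "\<bar>x9\<bar> = 2 * s ^ 9 * \<bar>Re (w ^ 3)\<bar> * \<bar>Re (\<i> * e ^ 8)\<bar>"
      using s by (simp add: x9_def abs_mult)
    also have "\<dots> \<le> 2 * 0.1004 * 1 * (8 * (B * E))"
      using s9 Rw[of 3] e8 B s E0 by (intro mult_mono) auto
    finally show ?thesis by linarith
  qed
  have tail: "(\<Sum>m. s ^ (m + N)\<^sup>2) \<le> a / (1 - b)"
    if "s ^ N\<^sup>2 \<le> a" "s ^ (2 * N + 1) \<le> b" "b < 1" for N a b
  proof -
    have "(\<Sum>m. s ^ (m + N)\<^sup>2) \<le> s ^ N\<^sup>2 / (1 - s ^ (2 * N + 1))"
      by (rule square_powers_tail) (use s s1 in auto)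
    also have "\<dots> \<le> a / (1 - b)"
      using that s order_trans[OF zero_le_power[OF less_imp_le[OF s(1)]] that(1)]
      by (intro frac_le) auto
    finally show ?thesis .
  qed
  have s_lt: "s < 1" using s1 by simp
  define X where "X = Re (?u * ?G)"
  have core: "X \<ge> B + (\<Sum>m=1..<N. 2 * s ^ m\<^sup>2 * Re (w ^ m) * Re (\<i> * e ^ (m\<^sup>2 - 1)))
      - (\<Sum>m. s ^ (m + N)\<^sup>2) - (\<Sum>m=N..k. s ^ m\<^sup>2)" if "1 \<le> N" "N \<le> k + 1" for N
    using symmetric_series_core_estimate[OF p e w s(1) s_lt that] by (simp only: X_def B_def)
  have "X > 0"
  proof -
    consider "k = 1" | "k = 2" | "k \<ge> 3" using k by linarith
    thus ?thesis
    proof cases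
      \<comment> \<open>The lower sum is empty, and the tail is below 0.5 < 0.707.\<close>
      case 1
      have "{1..<2::nat} = {1}" by auto
      hence "X \<ge> B - (\<Sum>m. s ^ (m + 2)\<^sup>2)"
        using core[of 2] 1 by simp
      moreover have "(\<Sum>m. s ^ (m + 2)\<^sup>2) \<le> 0.36 / (1 - 0.279)"
        by (rule tail) (use s4 s5 in auto)
      ultimately show ?thesis using B7 by simp
    next
      \<comment> \<open>At least 0.28 B > 0.19 remains against a tail below 0.13.\<close>
      case 2
      have "{1..<3::nat} = {1, 2}" by auto
      hence "X \<ge> B + x4 - (\<Sum>m. s ^ (m + 3)\<^sup>2)"
        using core[of 3] 2 by (simp add: x4_def)
      moreover have "D \<le> 1" using A2 by (auto simp: D_def abs_if)
      hence "x4 \<ge> - 0.72 * B"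
        by (intro order_trans[OF _ X4]) (use B in simp)
      moreover have "(\<Sum>m. s ^ (m + 3)\<^sup>2) \<le> 0.1004 / (1 - 0.1674)"
        by (rule tail) (use s9 s7 in auto)
      ultimately show ?thesis using B7 by simp
    next
      case 3
      have sm4: "summable (\<lambda>m. s ^ (m + 4)\<^sup>2)"
        by (rule square_powers_tail) (use s s_lt in auto)
      \<comment> \<open>Extending the lower sum to infinity makes the bound uniform in k.\<close>
      have "(\<Sum>m=4..k. s ^ m\<^sup>2) = (\<Sum>m<k - 3. s ^ (m + 4)\<^sup>2)"
        by (rule sum.reindex_bij_witness[of _ "\<lambda>m. m + 4" "\<lambda>m. m - 4"]) auto
      also have "\<dots> \<le> (\<Sum>m. s ^ (m + 4)\<^sup>2)"
        using s by (intro sum_le_suminf sm4) auto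
      finally have gap: "(\<Sum>m=4..k. s ^ m\<^sup>2) \<le> (\<Sum>m. s ^ (m + 4)\<^sup>2)" .
      have "{1..<4::nat} = {1, 2, 3}" by auto
      hence "X \<ge> B + x4 + x9 - 2 * (\<Sum>m. s ^ (m + 4)\<^sup>2)"
        using core[of 4] 3 gap by (simp add: x4_def x9_def)
      moreover have "(\<Sum>m. s ^ (m + 4)\<^sup>2) \<le> 0.0168 / (1 - 0.1004)"
        by (rule tail) (use s16 s9 in auto)
      \<comment> \<open>0.0433 = 0.866 * 0.05 exceeds the two tails, which total less than
        0.0374.\<close>
      moreover have "B * (1 - 0.72 * D - 1.6064 * E) \<ge> 0.0433"
      proof (cases "4 * A\<^sup>2 \<ge> 1")
        case True
        \<comment> \<open>This crude bound keeps 2 * 1.6064 * 0.89 just below 4 * 0.72, so the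
          resulting affine bound decreases in A^2; its value at A^2 = 1/2 is 0.28.\<close>
        have "\<bar>A\<bar> \<le> 0.89"
          by (rule power2_le_imp_le) (use A2 in \<open>auto simp: power2_eq_square\<close>)
        hence "E \<le> 0.89 * (1 - 2 * A\<^sup>2)"
          unfolding E_def using A2 by (intro mult_right_mono) auto
        hence "1 - 0.72 * D - 1.6064 * E \<ge> 0.28"
          using True A2 by (simp add: D_def field_simps)
        hence "B * (1 - 0.72 * D - 1.6064 * E) \<ge> 0.707 * 0.28"
          using B7 by (intro mult_mono) auto
        thus ?thesis by simp
      next
        case False
        (* 0.2788 is near the minimiser of 1 - 0.72 (1 - 4 x^2) - 1.6064 x. *)
        have "E \<le> \<bar>A\<bar> * 1"
          unfolding E_def by (intro mult_left_mono) auto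
        moreover have "0 \<le> (\<bar>A\<bar> - 0.2788)\<^sup>2" by simp
        hence "0 \<le> A\<^sup>2 - 0.5576 * \<bar>A\<bar> + 0.07772944"
          by (simp add: power2_eq_square algebra_simps)
        ultimately have "1 - 0.72 * D - 1.6064 * E \<ge> 0.05"
          using False by (simp add: D_def field_simps)
        \<comment> \<open>A^2 < 1/4 gives B^2 > 3/4, and 0.866 < sqrt 3 / 2.\<close>
        moreover have "B \<ge> 0.866"
          by (rule power2_le_imp_le) (use AB1 False B in \<open>auto simp: power2_eq_square\<close>)
        ultimately have "B * (1 - 0.72 * D - 1.6064 * E) \<ge> 0.866 * 0.05"
          by (intro mult_mono) auto
        thus ?thesis by simp
      qed
      ultimately show ?thesis using X4 X9 by (simp add: algebra_simps)
    qed
  qed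
  thus ?thesis by (simp only: X_def)
qed

section \<open>Locating the zeros of theta for parameters in the sector\<close>

lemma partial_theta_positive:
  assumes q: "q \<in> theta_sector 0.6" and k: "k \<ge> 1"
  shows "\<exists>\<mu>. \<forall>z. norm z = norm q powr (- (real k + 1 / 2)) \<longrightarrow>
    Re (\<mu> * partial_theta q z / z ^ k) > 0"
proof -
  have q0: "q \<noteq> 0" "norm q \<le> 0.6" and "Arg2pi q \<in> {pi / 2..3 * pi / 2}"
    using q by (auto simp: theta_sector_def)
  hence "cos (Arg2pi q - pi) \<ge> 0" by (intro cos_ge_zero) auto
  hence "cos (Arg2pi q) \<le> 0" by simp
  hence Req: "Re q \<le> 0" by (metis cos_Arg2pi mult_nonneg_nonpos norm_ge_zero)
  have sq: "(Re x)\<^sup>2 \<le> (Im x)\<^sup>2" if "x\<^sup>2 = q" for x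
    using Req that by (auto simp: power2_eq_square)
  \<comment> \<open>A real square root would be 0 because Re q <= 0, so one of the two roots lies in
    the upper half plane.\<close>
  have "\<exists>p. p\<^sup>2 = q \<and> Im p > 0"
  proof -
    have "Im x \<noteq> 0" if "x\<^sup>2 = q" for x
    proof
      assume "Im x = 0"
      with sq[OF that] have "x = 0" by (simp add: complex_eq_iff)
      thus False using q0 that by simp
    qed
    moreover obtain x where "x\<^sup>2 = q" by (metis power2_csqrt)
    ultimately have "x\<^sup>2 = q \<and> Im x > 0 \<or> (- x)\<^sup>2 = q \<and> Im (- x) > 0" by force
    thus ?thesis by blast
  qed
  then obtain p where p: "p\<^sup>2 = q" "Im p > 0" by blast
  define s where "s = norm p"
  define e where "e = p / of_real s"
  have "p \<noteq> 0" using p by auto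
  hence s: "s > 0" by (simp add: s_def)
  have s2: "s\<^sup>2 = norm q" by (simp add: s_def p(1)[symmetric] norm_power)
  have s1: "s < 1"
    by (rule power2_less_imp_less) (use s2 q0 in auto)
  have pe: "p = of_real s * e" using s by (simp add: e_def)
  have e: "norm e = 1" using s by (simp add: e_def norm_divide s_def)
  have Ime: "Im e > 0" using s p(2) by (simp add: e_def)
  have "(Re e)\<^sup>2 \<le> (Im e)\<^sup>2"
    using sq[OF p(1)] s by (simp add: e_def power_divide divide_right_mono)
  note pos = symmetric_series_positive[OF pe e _ s _ k Ime this]
  \<comment> \<open>Cancels the prefactor from completing the square and applies the rotation of the
    half plane.\<close>
  define \<mu> where "\<mu> = \<i> * cnj e / p ^ (k\<^sup>2 + k)"
  show ?thesis
  proof (intro exI[of _ \<mu>] allI impI)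
    fix z :: complex assume z: "norm z = norm q powr (- (real k + 1 / 2))"
    define w where "w = z * p ^ (2 * k + 1)"
    have "norm q = s powr 2" using s s2 by (simp add: powr_numeral)
    hence "norm z = s powr - real (2 * k + 1)"
      unfolding z by (simp only: powr_powr) (rule arg_cong[of _ _ "(powr) s"], simp)
    hence w1: "norm w = 1"
      using s by (simp add: w_def norm_mult norm_power s_def[symmetric] powr_minus powr_realpow field_simps
          del: of_nat_Suc of_nat_add)
    have "z \<noteq> 0" using w1 by (auto simp: w_def)
    have "partial_theta q z = p ^ (k\<^sup>2 + k) * z ^ k *
        ((\<Sum>m. p ^ m\<^sup>2 * w ^ m) + (\<Sum>m=1..k. p ^ m\<^sup>2 * cnj w ^ m))"
      unfolding p(1)[symmetric]
      by (rule partial_theta_rescaled) (use w1 w_def s1 s_def in auto)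
    hence "\<mu> * partial_theta q z / z ^ k =
        \<i> * cnj e * ((\<Sum>m. p ^ m\<^sup>2 * w ^ m) + (\<Sum>m=1..k. p ^ m\<^sup>2 * cnj w ^ m))"
      using \<open>p \<noteq> 0\<close> \<open>z \<noteq> 0\<close> by (simp add: \<mu>_def)
    thus "Re (\<mu> * partial_theta q z / z ^ k) > 0"
      using pos[OF w1] s2 q0 by simp
  qed
qed

text \<open>The half plane bound serves twice: it gives the count inside, and it keeps zeros off the
  circle, so that annuli can be handled by subtracting discs.\<close>

lemma partial_theta_zero_count:
  assumes q: "q \<in> theta_sector 0.6" and k: "k \<ge> 1"
  shows "has_zero_count (partial_theta q) (ball 0 (norm q powr (- (real k + 1 / 2)))) k"
    and "norm z = norm q powr (- (real k + 1 / 2)) \<Longrightarrow> partial_theta q z \<noteq> 0"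
proof -
  have q0: "norm q > 0" "norm q < 1" using q by (auto simp: theta_sector_def)
  obtain \<mu> where \<mu>: "\<And>z. norm z = norm q powr (- (real k + 1 / 2)) \<Longrightarrow>
      Re (\<mu> * partial_theta q z / z ^ k) > 0"
    using partial_theta_positive[OF q k] by blast
  show "has_zero_count (partial_theta q) (ball 0 (norm q powr (- (real k + 1 / 2)))) k"
    by (rule zero_count_ball[OF partial_theta_holomorphic[OF q0(2)] _ \<mu>]) (use q0 in auto)
  show "partial_theta q z \<noteq> 0" if "norm z = norm q powr (- (real k + 1 / 2))"
    using \<mu>[OF that] by auto
qed

lemma partial_theta_annulus_count:
  assumes q: "q \<in> theta_sector 0.6" and k: "1 \<le> k" "k \<le> l"
  shows "has_zero_count (partial_theta q) (theta_annulus q (real k + 1 / 2) (real l + 1 / 2)) (l - k)"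
proof (rule has_zero_count_diff[OF partial_theta_zero_count(1)[OF q k(1)]
      partial_theta_zero_count(1)[OF q order_trans[OF k]] _ _ k(2)])
  have q0: "norm q > 0" "norm q < 1" using q by (auto simp: theta_sector_def)
  have le: "norm q powr (- (real k + 1 / 2)) \<le> norm q powr (- (real l + 1 / 2))"
    using q0 k by (intro powr_mono') auto
  show "zeros_in (partial_theta q) (ball 0 (norm q powr - (real k + 1 / 2)))
      \<subseteq> zeros_in (partial_theta q) (ball 0 (norm q powr - (real l + 1 / 2)))"
    using le by (auto simp: zeros_in_def)
  show "zeros_in (partial_theta q) (theta_annulus q (real k + 1 / 2) (real l + 1 / 2)) =
      zeros_in (partial_theta q) (ball 0 (norm q powr - (real l + 1 / 2))) -
      zeros_in (partial_theta q) (ball 0 (norm q powr - (real k + 1 / 2)))"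
  proof -
    have "norm z > norm q powr - (real k + 1 / 2) \<longleftrightarrow> \<not> norm z < norm q powr - (real k + 1 / 2)"
      if "partial_theta q z = 0" for z
      using partial_theta_zero_count(2)[OF q k(1), of z] that by (meson linorder_cases less_asym)
    thus ?thesis unfolding zeros_in_def theta_annulus_def by auto
  qed
qed

text \<open>For k = 1 the puncture loses nothing, as theta is 1 at 0. For k >= 2 the bounding
  circles enclose k - 1 and k zeros.\<close>

lemma partial_theta_region_simple_zero:
  assumes q: "q \<in> theta_sector 0.6" and k: "k \<ge> 1"
  shows "\<exists>w. only_simple_zero_in (partial_theta q) (theta_region q k) w"
proof (rule only_simple_zero_in_if_count_1)
  have q1: "norm q < 1" using q by (auto simp: theta_sector_def)
  show "zorder (partial_theta q) z > 0" if "partial_theta q z = 0" for z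
    by (rule zorder_partial_theta_pos[OF q1 that])
  show "has_zero_count (partial_theta q) (theta_region q k) 1"
  proof (cases "k = 1")
    case True
    have "zeros_in (partial_theta q) (theta_disk q (3 / 2)) =
        zeros_in (partial_theta q) (ball 0 (norm q powr - (real 1 + 1 / 2)))"
      by (auto simp: zeros_in_def theta_disk_def intro: ccontr)
    thus ?thesis
      using partial_theta_zero_count(1)[OF q, of 1] True by (simp add: has_zero_count_def theta_region_def)
  next
    case False
    hence "real (k - 1) + 1 / 2 = real k - 1 / 2" using k by (simp add: of_nat_diff)
    moreover have "k - (k - 1) = 1" using k by simp
    ultimately show ?thesis
      using partial_theta_annulus_count[OF q, of "k - 1" k] k False
      by (simp add: theta_region_def)
  qed
qed

lemma partial_theta_zero_in_region:
  assumes q: "q \<in> theta_sector 0.6" and z: "partial_theta q z = 0"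
  shows "\<exists>k\<ge>1. z \<in> theta_region q k"
proof -
  have q0: "norm q > 0" "norm q < 1" using q by (auto simp: theta_sector_def)
  have "z \<noteq> 0" using z by auto
  define R where "R k = norm q powr (- (real k + 1 / 2))" for k
  have "\<exists>k\<ge>1. norm z < R k"
  proof -
    obtain n where n: "inverse (norm q) ^ n > norm z"
      using real_arch_pow[of "inverse (norm q)"] q0 by (auto simp: one_less_inverse)
    have "inverse (norm q) ^ n = norm q powr - real n"
      using q0 by (simp add: powr_minus powr_realpow power_inverse)
    also have "\<dots> \<le> R (Suc n)"
      unfolding R_def using q0 by (intro powr_mono') auto
    finally have "norm z < R (Suc n)" using n by linarith
    thus ?thesis by (intro exI[of _ "Suc n"]) auto
  qed
  \<comment> \<open>Minimality puts z outside the previous open disc, and that circle carries no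
    zero.\<close>
  define k where "k = (LEAST k. k \<ge> 1 \<and> norm z < R k)"
  have k: "k \<ge> 1" "norm z < R k"
    using LeastI_ex[of "\<lambda>k. k \<ge> 1 \<and> norm z < R k"] \<open>\<exists>k\<ge>1. norm z < R k\<close>
    unfolding k_def by blast+
  have "z \<in> theta_region q k"
  proof (cases "k = 1")
    case True
    thus ?thesis using k \<open>z \<noteq> 0\<close> by (simp add: theta_region_def theta_disk_def R_def)
  next
    case False
    hence k1: "k - 1 \<ge> 1" using k by simp
    have "\<not> norm z < R (k - 1)"
      using not_less_Least[of "k - 1" "\<lambda>k. k \<ge> 1 \<and> norm z < R k"] k1
      unfolding k_def[symmetric] by auto
    moreover have "norm z \<noteq> R (k - 1)"
      using partial_theta_zero_count(2)[OF q k1, of z] z by (auto simp: R_def)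
    moreover have "real (k - 1) + 1 / 2 = real k - 1 / 2" using k by (simp add: of_nat_diff)
    ultimately show ?thesis
      using k False by (simp add: theta_region_def theta_annulus_def R_def)
  qed
  thus ?thesis using k by blast
qed

lemma strongly_separated_theta_sector:
  assumes q: "q \<in> theta_sector 0.6"
  shows "strongly_separated q"
proof -
  have q1: "norm q < 1" using q by (auto simp: theta_sector_def)
  have "\<forall>k\<in>{1..}. \<exists>w. only_simple_zero_in (partial_theta q) (theta_region q k) w"
    using partial_theta_region_simple_zero[OF q] by simp
  then obtain \<xi> where \<xi>: "\<And>k. k \<ge> 1 \<Longrightarrow>
      only_simple_zero_in (partial_theta q) (theta_region q k) (\<xi> k)"
    by (auto dest!: bchoice)
  have \<xi>_iff: "z = \<xi> k \<longleftrightarrow> z \<in> theta_region q k \<and> partial_theta q z = 0" if "k \<ge> 1" for z k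
    using \<xi>[OF that] by (auto simp: only_simple_zero_in_def zeros_in_def set_eq_iff)
  have "zeros_in (partial_theta q) (- (\<xi> ` {1..})) = {}"
  proof -
    have "z \<in> \<xi> ` {1..}" if "partial_theta q z = 0" for z
    proof -
      obtain k where "k \<ge> 1" "z \<in> theta_region q k"
        using partial_theta_zero_in_region[OF q \<open>partial_theta q z = 0\<close>] by blast
      thus ?thesis using \<xi>_iff that by blast
    qed
    thus ?thesis by (auto simp: zeros_in_def)
  qed
  \<comment> \<open>With k0 = 1 the required count of remaining zeros is 1 - 1 = 0, met by the empty
    set.\<close>
  thus ?thesis
    unfolding strongly_separated_def strongly_separated_from_def
    using \<xi> by (intro exI[of _ \<xi>]) (simp add: has_zero_count_def)
qed

theorem theorem2:
  shows "(\<forall>q \<in> theta_sector 0.55. strongly_separated q) \<and>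
    (\<forall>q \<in> theta_sector 0.6.
      (\<forall>k::nat. k \<ge> 4 \<longrightarrow>
        (\<exists>w. only_simple_zero_in (partial_theta q)
          (theta_annulus q (real k - 1 / 2) (real k + 1 / 2)) w)) \<and>
      (\<exists>w. only_simple_zero_in (partial_theta q) (theta_disk q (3 / 2)) w) \<and>
      has_zero_count (partial_theta q) (theta_annulus q (3 / 2) (7 / 2)) 2)"
proof (intro conjI ballI allI impI)
  fix q assume "q \<in> theta_sector 0.55"
  hence "q \<in> theta_sector 0.6" by (auto simp: theta_sector_def)
  thus "strongly_separated q" by (rule strongly_separated_theta_sector)
next
  fix q :: complex and k :: nat
  assume q: "q \<in> theta_sector 0.6" and "4 \<le> k"
  thus "\<exists>w. only_simple_zero_in (partial_theta q) (theta_annulus q (real k - 1 / 2) (real k + 1 / 2)) w"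
    using partial_theta_region_simple_zero[OF q, of k] by (simp add: theta_region_def)
next
  fix q assume q: "q \<in> theta_sector 0.6"
  show "\<exists>w. only_simple_zero_in (partial_theta q) (theta_disk q (3 / 2)) w"
    using partial_theta_region_simple_zero[OF q, of 1] by (simp add: theta_region_def)
  show "has_zero_count (partial_theta q) (theta_annulus q (3 / 2) (7 / 2)) 2"
    \<comment> \<open>The two circles enclose 1 and 3 zeros.\<close>
    using partial_theta_annulus_count[OF q, of 1 3] by simp
qed

end
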